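(* Let $\Sigma$ be a connected graph of diameter $d$ with $|V(\Sigma)|\geqslant2$, such that $S(\Sigma)$ has diameter $2d+\delta$ for some $\delta\in\{0,1,2\}$, let $G\leqslant\mathrm{Aut}(\Sigma)$, and suppose $\Sigma\neq K_2$. Then the following four conditions are equivalent. (a) $S(\Sigma)$ is locally $(G,2)$-distance transitive. (b) $\Sigma$ is $(G,2)$-arc transitive. (c) $S(\Sigma)$ is locally $(G,3)$-arc transitive. (d) $S(\Sigma)$ is locally $(G,3)$-distance transitive.
   Context: Graphs are simple and undirected; $V(\Sigma)$ and $E(\Sigma)$ denote the vertex set and edge set (edges are unordered pairs of vertices). The subdivision graph $S(\Sigma)$ has vertex set $V(\Sigma)\cup E(\Sigma)$ and edge set $\{\{x,e\}\mid x\in V(\Sigma), e\in E(\Sigma), x\in e\}$. $\mathrm{Aut}(\Sigma)$ acts naturally on $V(\Sigma)\cup E(\Sigma)$ preserving incidence, so $G\leqslant\mathrm{Aut}(\Sigma)$ acts on $S(\Sigma)$ by automorphisms. $K_2$ is the complete graph on two vertices. The diameter $d$ is finite; the condition on $\delta$ then holds automatically. For a graph $\Gamma$ and a positive integer $i$, an $i$-arc of $\Gamma$ is an $(i+1)$-tuple $(v_0,\dots,v_i)$ of vertices with $\{v_{j-1},v_j\}\in E(\Gamma)$ for $1\leqslant j\leqslant i$ and $v_{j-1}\ne v_{j+1}$ for $1\leqslant j\leqslant i-1$. $\Gamma_i(v)$ denotes the set of vertices at distance exactly $i$ from $v$. Let $G$ act on the connected graph $\Gamma$ by automorphisms, and let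 $s\geqslant1$. $\Gamma$ is $(G,s)$-arc transitive if $\Gamma$ has at least one $s$-arc and, for each $1\leqslant i\leqslant s$, $G$ is transitive on the set of $i$-arcs of $\Gamma$. $\Gamma$ is locally $(G,s)$-arc transitive (respectively locally $(G,s)$-distance transitive) if, for every vertex $v$ and each $1\leqslant i\leqslant s$, the stabiliser $G_v$ is transitive on $\Delta_i(v)$ (vacuously true if $\Delta_i(v)=\emptyset$), and $\Delta_s(v)\neq\emptyset$ for some $v$, where $\Delta_i(v)$ is the set of $i$-arcs of $\Gamma$ with initial vertex $v$ (respectively $\Delta_i(v)=\Gamma_i(v)$). *)

theory Defs
  imports
    "HOL-Algebra.Group_Action"
    "HOL-Library.Extended_Nat"
    "HOL-Library.Ramsey"
begin

section \<open>Simple undirected graphs\<close>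

text \<open>
  Edges are unordered pairs, represented as two-element sets.  Graphs are not assumed to be
  finite.
\<close>

record 'a ugraph =
  verts :: "'a set"
  edges :: "'a set set"

definition simple_graph :: "'a ugraph \<Rightarrow> bool" where
  "simple_graph \<Gamma> \<longleftrightarrow> edges \<Gamma> \<subseteq> [verts \<Gamma>]\<^bsup>2\<^esup>"

definition complete_graph :: "nat \<Rightarrow> nat ugraph" where
  "complete_graph n = \<lparr>verts = {..<n}, edges = [{..<n}]\<^bsup>2\<^esup>\<rparr>"

definition graph_iso :: "('a \<Rightarrow> 'b) \<Rightarrow> 'a ugraph \<Rightarrow> 'b ugraph \<Rightarrow> bool" where
  "graph_iso f \<Gamma> \<Delta> \<longleftrightarrow>
     bij_betw f (verts \<Gamma>) (verts \<Delta>) \<and>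
     (\<forall>x\<in>verts \<Gamma>. \<forall>y\<in>verts \<Gamma>. {x, y} \<in> edges \<Gamma> \<longleftrightarrow> {f x, f y} \<in> edges \<Delta>)"

definition isomorphic_graphs :: "'a ugraph \<Rightarrow> 'b ugraph \<Rightarrow> bool" where
  "isomorphic_graphs \<Gamma> \<Delta> \<longleftrightarrow> (\<exists>f. graph_iso f \<Gamma> \<Delta>)"


section \<open>Distance, connectedness and diameter\<close>

definition walk_betw :: "'a ugraph \<Rightarrow> 'a \<Rightarrow> 'a list \<Rightarrow> 'a \<Rightarrow> bool" where
  "walk_betw \<Gamma> u p v \<longleftrightarrow>
     p \<noteq> [] \<and> hd p = u \<and> last p = v \<and> set p \<subseteq> verts \<Gamma> \<and>
     successively (\<lambda>x y. {x, y} \<in> edges \<Gamma>) p"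

definition connected_graph :: "'a ugraph \<Rightarrow> bool" where
  "connected_graph \<Gamma> \<longleftrightarrow>
     verts \<Gamma> \<noteq> {} \<and> (\<forall>u\<in>verts \<Gamma>. \<forall>v\<in>verts \<Gamma>. \<exists>p. walk_betw \<Gamma> u p v)"

text \<open>The value is \<open>\<infinity>\<close> if there is no walk from \<open>u\<close> to \<open>v\<close>.\<close>

definition graph_dist :: "'a ugraph \<Rightarrow> 'a \<Rightarrow> 'a \<Rightarrow> enat" where
  "graph_dist \<Gamma> u v = (INF p \<in> {p. walk_betw \<Gamma> u p v}. enat (length p - 1))"

definition graph_diameter :: "'a ugraph \<Rightarrow> enat" where
  "graph_diameter \<Gamma> = (SUP u \<in> verts \<Gamma>. SUP v \<in> verts \<Gamma>. graph_dist \<Gamma> u v)"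

definition dist_set :: "'a ugraph \<Rightarrow> nat \<Rightarrow> 'a \<Rightarrow> 'a set" where
  "dist_set \<Gamma> i v = {u \<in> verts \<Gamma>. graph_dist \<Gamma> v u = enat i}"


section \<open>Arcs\<close>

definition arcs :: "'a ugraph \<Rightarrow> nat \<Rightarrow> 'a list set" where
  "arcs \<Gamma> i =
     {p. length p = i + 1 \<and> set p \<subseteq> verts \<Gamma> \<and>
         (\<forall>j\<in>{1..i}. {p ! (j - 1), p ! j} \<in> edges \<Gamma>) \<and>
         (\<forall>j\<in>{1..i - 1}. p ! (j - 1) \<noteq> p ! (j + 1))}"

definition arcs_from :: "'a ugraph \<Rightarrow> nat \<Rightarrow> 'a \<Rightarrow> 'a list set" where
  "arcs_from \<Gamma> i v = {p \<in> arcs \<Gamma> i. hd p = v}"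


section \<open>Automorphisms\<close>

text \<open>
  As in \<^theory>\<open>HOL-Algebra.Bij\<close>, permutations of the vertex set are extensional functions, so
  that distinct functions are distinct permutations.
\<close>

definition graph_aut :: "'a ugraph \<Rightarrow> ('a \<Rightarrow> 'a) set" where
  "graph_aut \<Gamma> = {f \<in> Bij (verts \<Gamma>). graph_iso f \<Gamma> \<Gamma>}"

definition aut_group :: "'a ugraph \<Rightarrow> ('a \<Rightarrow> 'a) monoid" where
  "aut_group \<Gamma> = BijGroup (verts \<Gamma>) \<lparr>carrier := graph_aut \<Gamma>\<rparr>"


section \<open>Transitivity properties\<close>

text \<open>
  Below, \<open>G\<close> is a group acting by automorphisms on a connected graph \<open>\<Gamma>\<close> through \<open>\<phi>\<close>
  (that is, \<open>\<phi> \<in> hom G (aut_group \<Gamma>)\<close>), and \<open>s \<ge> 1\<close>.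
\<close>

definition transitive_on :: "'g set \<Rightarrow> ('g \<Rightarrow> 'x \<Rightarrow> 'x) \<Rightarrow> 'x set \<Rightarrow> bool" where
  "transitive_on H \<psi> X \<longleftrightarrow> (\<forall>x\<in>X. \<forall>y\<in>X. \<exists>g\<in>H. \<psi> g x = y)"

definition arc_transitive ::
    "('g, 'm) monoid_scheme \<Rightarrow> ('g \<Rightarrow> 'a \<Rightarrow> 'a) \<Rightarrow> 'a ugraph \<Rightarrow> nat \<Rightarrow> bool" where
  "arc_transitive G \<phi> \<Gamma> s \<longleftrightarrow>
     arcs \<Gamma> s \<noteq> {} \<and>
     (\<forall>i\<in>{1..s}. transitive_on (carrier G) (\<lambda>g. map (\<phi> g)) (arcs \<Gamma> i))"

definition locally_arc_transitive ::
    "('g, 'm) monoid_scheme \<Rightarrow> ('g \<Rightarrow> 'a \<Rightarrow> 'a) \<Rightarrow> 'a ugraph \<Rightarrow> nat \<Rightarrow> bool" where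
  "locally_arc_transitive G \<phi> \<Gamma> s \<longleftrightarrow>
     (\<forall>v\<in>verts \<Gamma>. \<forall>i\<in>{1..s}.
        transitive_on (stabilizer G \<phi> v) (\<lambda>g. map (\<phi> g)) (arcs_from \<Gamma> i v)) \<and>
     (\<exists>v\<in>verts \<Gamma>. arcs_from \<Gamma> s v \<noteq> {})"

definition locally_distance_transitive ::
    "('g, 'm) monoid_scheme \<Rightarrow> ('g \<Rightarrow> 'a \<Rightarrow> 'a) \<Rightarrow> 'a ugraph \<Rightarrow> nat \<Rightarrow> bool" where
  "locally_distance_transitive G \<phi> \<Gamma> s \<longleftrightarrow>
     (\<forall>v\<in>verts \<Gamma>. \<forall>i\<in>{1..s}.
        transitive_on (stabilizer G \<phi> v) \<phi> (dist_set \<Gamma> i v)) \<and>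
     (\<exists>v\<in>verts \<Gamma>. dist_set \<Gamma> s v \<noteq> {})"


section \<open>The subdivision graph\<close>

definition subdivision :: "'a ugraph \<Rightarrow> ('a + 'a set) ugraph" where
  "subdivision \<Gamma> =
     \<lparr>verts = verts \<Gamma> <+> edges \<Gamma>,
      edges = {{Inl x, Inr e} | x e. x \<in> verts \<Gamma> \<and> e \<in> edges \<Gamma> \<and> x \<in> e}\<rparr>"

definition subdivision_action :: "'a ugraph \<Rightarrow> ('a \<Rightarrow> 'a) \<Rightarrow> ('a + 'a set) \<Rightarrow> ('a + 'a set)" where
  "subdivision_action \<Gamma> g =
     restrict (map_sum g (image g)) (verts (subdivision \<Gamma>))"

lemma simple_graph_edgeE:
  assumes "simple_graph \<Gamma>" "e \<in> edges \<Gamma>"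
  obtains x y where "e = {x, y}" "x \<in> verts \<Gamma>" "y \<in> verts \<Gamma>" "x \<noteq> y"
proof -
  have "e \<in> [verts \<Gamma>]\<^bsup>2\<^esup>" using assms by (auto simp: simple_graph_def)
  then show ?thesis using that by (auto simp: nsets_2_eq)
qed

lemma simple_graph_subdivision:
  assumes "simple_graph \<Gamma>"
  shows "simple_graph (subdivision \<Gamma>)"
  by (auto simp: simple_graph_def subdivision_def)

lemma subgroup_graph_aut: "subgroup (graph_aut \<Gamma>) (BijGroup (verts \<Gamma>))"
proof (rule subgroup.intro)
  show "graph_aut \<Gamma> \<subseteq> carrier (BijGroup (verts \<Gamma>))"
    by (auto simp: graph_aut_def BijGroup_def)
next
  fix f g assume f: "f \<in> graph_aut \<Gamma>" and g: "g \<in> graph_aut \<Gamma>"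
  then have B: "f \<in> Bij (verts \<Gamma>)" "g \<in> Bij (verts \<Gamma>)" by (auto simp: graph_aut_def)
  have "compose (verts \<Gamma>) f g \<in> Bij (verts \<Gamma>)" using B by (rule compose_Bij)
  moreover have "g x \<in> verts \<Gamma>" if "x \<in> verts \<Gamma>" for x
    using Bij_imp_funcset[OF B(2)] that by blast
  ultimately show "f \<otimes>\<^bsub>BijGroup (verts \<Gamma>)\<^esub> g \<in> graph_aut \<Gamma>"
    using f g B by (auto simp: graph_aut_def BijGroup_def graph_iso_def Bij_def compose_eq)
next
  show "\<one>\<^bsub>BijGroup (verts \<Gamma>)\<^esub> \<in> graph_aut \<Gamma>"
    using id_Bij[of "verts \<Gamma>"] by (auto simp: graph_aut_def BijGroup_def graph_iso_def Bij_def)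
next
  fix f assume f: "f \<in> graph_aut \<Gamma>"
  then have B: "f \<in> Bij (verts \<Gamma>)" by (auto simp: graph_aut_def)
  let ?h = "inv_into (verts \<Gamma>) f"
  have im: "f ` verts \<Gamma> = verts \<Gamma>" using B by (auto simp: Bij_def bij_betw_def)
  have "?h x \<in> verts \<Gamma>" "f (?h x) = x" if "x \<in> verts \<Gamma>" for x
    using that im by (simp_all add: inv_into_into f_inv_into_f)
  then show "inv\<^bsub>BijGroup (verts \<Gamma>)\<^esub> f \<in> graph_aut \<Gamma>"
    using f restrict_inv_into_Bij[OF B] unfolding inv_BijGroup[OF B]
    by (auto simp: graph_aut_def graph_iso_def Bij_def)
qed

lemma group_aut_group: "group (aut_group \<Gamma>)"
  by (simp add: aut_group_def subgroup.subgroup_is_group subgroup_graph_aut group_BijGroup)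

lemma graph_aut_image_edge:
  assumes "simple_graph \<Gamma>" "g \<in> graph_aut \<Gamma>" "e \<in> edges \<Gamma>"
  shows "g ` e \<in> edges \<Gamma>"
proof -
  obtain x y where e: "e = {x, y}" and xy: "x \<in> verts \<Gamma>" "y \<in> verts \<Gamma>"
    using simple_graph_edgeE[OF assms(1,3)] .
  have "{g x, g y} \<in> edges \<Gamma>" using assms(2,3) xy by (simp add: e graph_aut_def graph_iso_def)
  then show ?thesis by (simp add: e)
qed

lemma graph_aut_image_edges:
  assumes "simple_graph \<Gamma>" "g \<in> graph_aut \<Gamma>"
  shows "image g ` edges \<Gamma> = edges \<Gamma>"
proof
  show "image g ` edges \<Gamma> \<subseteq> edges \<Gamma>" using graph_aut_image_edge[OF assms] by blast
  show "edges \<Gamma> \<subseteq> image g ` edges \<Gamma>"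
  proof
    fix e assume e: "e \<in> edges \<Gamma>"
    obtain x y where xy: "e = {x, y}" "x \<in> verts \<Gamma>" "y \<in> verts \<Gamma>"
      using simple_graph_edgeE[OF assms(1) e] .
    have "g ` verts \<Gamma> = verts \<Gamma>" using assms(2) by (auto simp: graph_aut_def Bij_def bij_betw_def)
    then have "x \<in> g ` verts \<Gamma>" "y \<in> g ` verts \<Gamma>" using xy(2,3) by simp_all
    then obtain u v where uv: "u \<in> verts \<Gamma>" "v \<in> verts \<Gamma>" "x = g u" "y = g v"
      by (elim imageE)
    have "{g u, g v} \<in> edges \<Gamma>" using e by (simp add: xy(1) uv(3,4))
    then have "{u, v} \<in> edges \<Gamma>" using uv(1,2) assms(2) by (simp add: graph_aut_def graph_iso_def)
    moreover have "e = g ` {u, v}" using uv xy by auto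
    ultimately show "e \<in> image g ` edges \<Gamma>" by blast
  qed
qed

lemma subdivision_adj_iff:
  "{Inl x, Inr e} \<in> edges (subdivision \<Gamma>) \<longleftrightarrow> x \<in> verts \<Gamma> \<and> e \<in> edges \<Gamma> \<and> x \<in> e"
  "{Inr e, Inl x} \<in> edges (subdivision \<Gamma>) \<longleftrightarrow> x \<in> verts \<Gamma> \<and> e \<in> edges \<Gamma> \<and> x \<in> e"
  "{Inl x, Inl y} \<notin> edges (subdivision \<Gamma>)"
  "{Inr e, Inr e'} \<notin> edges (subdivision \<Gamma>)"
  by (auto simp: subdivision_def doubleton_eq_iff)

lemma subdivision_action_aut:
  assumes \<Gamma>: "simple_graph \<Gamma>" and g: "g \<in> graph_aut \<Gamma>"
  shows "subdivision_action \<Gamma> g \<in> graph_aut (subdivision \<Gamma>)"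
proof -
  let ?a = "subdivision_action \<Gamma> g" and ?V = "verts \<Gamma>" and ?E = "edges \<Gamma>"
  have inj: "inj_on g ?V" and im: "g ` ?V = ?V"
    using g by (auto simp: graph_aut_def Bij_def bij_betw_def)
  have sub: "e \<subseteq> ?V" if "e \<in> ?E" for e using simple_graph_edgeE[OF \<Gamma> that] by blast
  have V: "verts (subdivision \<Gamma>) = ?V <+> ?E" by (simp add: subdivision_def)
  have a [simp]: "x \<in> ?V \<Longrightarrow> ?a (Inl x) = Inl (g x)" "e \<in> ?E \<Longrightarrow> ?a (Inr e) = Inr (g ` e)" for x e
    by (auto simp: subdivision_action_def V)
  have gV: "g x \<in> ?V" if "x \<in> ?V" for x using that im by blast
  have gE: "g ` e \<in> ?E" if "e \<in> ?E" for e using graph_aut_image_edge[OF \<Gamma> g that] .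
  have bij: "bij_betw ?a (?V <+> ?E) (?V <+> ?E)"
    unfolding bij_betw_def
  proof
    show "inj_on ?a (?V <+> ?E)"
    proof (rule inj_onI)
      fix p q assume "p \<in> ?V <+> ?E" "q \<in> ?V <+> ?E" "?a p = ?a q"
      then show "p = q"
        by (elim PlusE) (simp_all add: inj_on_eq_iff[OF inj] inj_on_image_eq_iff[OF inj sub sub])
    qed
    have "?a ` (?V <+> ?E) = (Inl ` (g ` ?V)) \<union> (Inr ` (image g ` ?E))"
      by (simp add: Plus_def image_Un image_image)
    then show "?a ` (?V <+> ?E) = ?V <+> ?E"
      by (simp only: im graph_aut_image_edges[OF \<Gamma> g] Plus_def)
  qed
  have "g x \<in> g ` e \<longleftrightarrow> x \<in> e" if "x \<in> ?V" "e \<in> ?E" for x e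
    using inj_on_image_mem_iff[OF inj that(1) sub[OF that(2)]] .
  then have "graph_iso ?a (subdivision \<Gamma>) (subdivision \<Gamma>)"
    using bij by (auto simp: graph_iso_def V subdivision_adj_iff gV gE)
  moreover have "?a \<in> Bij (verts (subdivision \<Gamma>))"
    using bij by (auto simp: Bij_def V) (auto simp: subdivision_action_def V)
  ultimately show ?thesis by (simp add: graph_aut_def)
qed

lemma subdivision_action_hom:
  assumes \<Gamma>: "simple_graph \<Gamma>"
  shows "subdivision_action \<Gamma> \<in> hom (aut_group \<Gamma>) (aut_group (subdivision \<Gamma>))"
proof (rule homI)
  fix g assume "g \<in> carrier (aut_group \<Gamma>)"
  then show "subdivision_action \<Gamma> g \<in> carrier (aut_group (subdivision \<Gamma>))"
    using subdivision_action_aut[OF \<Gamma>] by (simp add: aut_group_def)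
next
  fix f g assume fg: "f \<in> carrier (aut_group \<Gamma>)" "g \<in> carrier (aut_group \<Gamma>)"
  then have f: "f \<in> graph_aut \<Gamma>" and g: "g \<in> graph_aut \<Gamma>" by (auto simp: aut_group_def)
  have B: "f \<in> Bij (verts \<Gamma>)" "g \<in> Bij (verts \<Gamma>)" using f g by (auto simp: graph_aut_def)
  have sB: "subdivision_action \<Gamma> f \<in> Bij (verts (subdivision \<Gamma>))"
    "subdivision_action \<Gamma> g \<in> Bij (verts (subdivision \<Gamma>))"
    using subdivision_action_aut[OF \<Gamma>] f g by (auto simp: graph_aut_def)
  have gV: "g x \<in> verts \<Gamma>" if "x \<in> verts \<Gamma>" for x
    using Bij_imp_funcset[OF B(2)] that by blast
  have gE: "g ` e \<in> edges \<Gamma>" if "e \<in> edges \<Gamma>" for e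
    using graph_aut_image_edge[OF \<Gamma> g that] .
  have sub: "e \<subseteq> verts \<Gamma>" if "e \<in> edges \<Gamma>" for e using simple_graph_edgeE[OF \<Gamma> that] by blast
  have V: "verts (subdivision \<Gamma>) = verts \<Gamma> <+> edges \<Gamma>" by (simp add: subdivision_def)
  have "compose (verts \<Gamma>) f g ` e = f ` g ` e" if "e \<in> edges \<Gamma>" for e
    using sub[OF that] by (force simp: compose_eq image_image subset_iff intro!: image_cong)
  then have "subdivision_action \<Gamma> (compose (verts \<Gamma>) f g) =
      compose (verts (subdivision \<Gamma>)) (subdivision_action \<Gamma> f) (subdivision_action \<Gamma> g)"
    by (auto simp: fun_eq_iff subdivision_action_def compose_def V gV gE restrict_def)
  then show "subdivision_action \<Gamma> (f \<otimes>\<^bsub>aut_group \<Gamma>\<^esub> g) =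
      subdivision_action \<Gamma> f \<otimes>\<^bsub>aut_group (subdivision \<Gamma>)\<^esub> subdivision_action \<Gamma> g"
    using B sB by (simp add: aut_group_def BijGroup_def)
qed

end

theory Submission
  imports Defs
begin

text \<open>
  Write \<open>S\<close> for the subdivision graph of \<open>\<Sigma>\<close>.  The four conditions follow from one another in a
  cycle, and each step compares short arcs of \<open>S\<close> with 2-arcs of \<open>\<Sigma>\<close>.  A connected graph with at
  least two vertices that is not \<open>K\<^sub>2\<close> has a 2-arc, which provides the arcs and
  distances whose existence the conditions demand.

  Distance transitivity up to 2 gives 2-arc transitivity
  (\<open>arc_transitive_2_if_locally_distance_transitive_2\<close>).  At distance 1 from an edge \<open>{x, y}\<close> lie
  \<open>x\<close> and \<open>y\<close>, so the stabiliser of an edge exchanges its ends; by connectedness \<open>G\<close> is transitive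
  on vertices.  At distance 2 from a vertex lie its neighbours, so \<open>G\<close> is transitive on 1-arcs.
  At distance 2 from the edge \<open>{x, y}\<close> lie the edges meeting it in one vertex.  An element that
  fixes \<open>{x, y}\<close> and sends \<open>{y, z}\<close> to \<open>{y, w}\<close>, where \<open>x\<close> is distinct from \<open>z\<close> and \<open>w\<close>, must fix
  the common vertex \<open>y\<close>, hence \<open>x\<close>, and send \<open>z\<close> to \<open>w\<close>.  So the stabiliser of a 1-arc is
  transitive on its extensions to 2-arcs.

  2-arc transitivity lifts to \<open>S\<close> (\<open>locally_arc_transitive_3_if_arc_transitive_2\<close>): a 2-arc
  \<open>(x, y, z)\<close> becomes the walk \<open>x, {x, y}, y, {y, z}, z\<close> of \<open>S\<close>, and every arc of \<open>S\<close> of length at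
  most 3 is a segment of such a walk, or of the one from a 1-arc, at a place that depends only on
  the length and on the kind of the initial vertex (\<open>arc_in_subdivision\<close>).

  Arc transitivity gives distance transitivity because a geodesic is an arc, so that each vertex at
  distance \<open>i\<close> is the end of an \<open>i\<close>-arc (\<open>transitive_on_dist_set_if_arcs\<close>).  Passing from
  distance 3 to distance 2 only drops a requirement.
\<close>

section \<open>Walks, distances and arcs\<close>

definition walk_of_length :: "'a ugraph \<Rightarrow> nat \<Rightarrow> 'a \<Rightarrow> 'a \<Rightarrow> bool" where
  "walk_of_length \<Gamma> n u v \<longleftrightarrow> (\<exists>p. walk_betw \<Gamma> u p v \<and> length p = Suc n)"

lemma walk_of_length_0: "walk_of_length \<Gamma> 0 u v \<longleftrightarrow> u = v \<and> v \<in> verts \<Gamma>"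
  by (auto simp: walk_of_length_def walk_betw_def length_Suc_conv)

lemma walk_of_length_Suc:
  "walk_of_length \<Gamma> (Suc n) u v \<longleftrightarrow>
     u \<in> verts \<Gamma> \<and> (\<exists>w. {u, w} \<in> edges \<Gamma> \<and> walk_of_length \<Gamma> n w v)"
proof
  assume "walk_of_length \<Gamma> (Suc n) u v"
  then obtain p where p: "walk_betw \<Gamma> u p v" "length p = Suc (Suc n)"
    by (auto simp: walk_of_length_def)
  then obtain w q where "p = u # w # q"
    by (auto simp: walk_betw_def length_Suc_conv)
  with p have "walk_betw \<Gamma> w (w # q) v" "length (w # q) = Suc n" "{u, w} \<in> edges \<Gamma>" "u \<in> verts \<Gamma>"
    by (auto simp: walk_betw_def)
  then show "u \<in> verts \<Gamma> \<and> (\<exists>w. {u, w} \<in> edges \<Gamma> \<and> walk_of_length \<Gamma> n w v)"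
    unfolding walk_of_length_def by blast
next
  assume "u \<in> verts \<Gamma> \<and> (\<exists>w. {u, w} \<in> edges \<Gamma> \<and> walk_of_length \<Gamma> n w v)"
  then obtain w p where "u \<in> verts \<Gamma>" "{u, w} \<in> edges \<Gamma>" "walk_betw \<Gamma> w p v" "length p = Suc n"
    by (auto simp: walk_of_length_def)
  then have "walk_betw \<Gamma> u (u # p) v" "length (u # p) = Suc (Suc n)"
    by (auto simp: walk_betw_def successively_Cons)
  then show "walk_of_length \<Gamma> (Suc n) u v" unfolding walk_of_length_def by blast
qed

lemma graph_dist_eq_enat_iff:
  "graph_dist \<Gamma> u v = enat n \<longleftrightarrow>
     walk_of_length \<Gamma> n u v \<and> (\<forall>m<n. \<not> walk_of_length \<Gamma> m u v)"
proof
  let ?L = "(\<lambda>p. enat (length p - 1)) ` {p. walk_betw \<Gamma> u p v}"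
  have len: "length p = Suc (length p - 1)" if "walk_betw \<Gamma> u p v" for p
    using that by (cases p) (auto simp: walk_betw_def)
  have low: "graph_dist \<Gamma> u v \<le> enat m" if "walk_of_length \<Gamma> m u v" for m
  proof -
    obtain p where "walk_betw \<Gamma> u p v" "length p = Suc m"
      using \<open>walk_of_length \<Gamma> m u v\<close> by (auto simp: walk_of_length_def)
    then show ?thesis unfolding graph_dist_def by (intro INF_lower2[of p]) auto
  qed
  have att: "walk_of_length \<Gamma> m u v" if "graph_dist \<Gamma> u v = enat m" for m
  proof -
    have "?L \<noteq> {}"
    proof
      assume "?L = {}"
      then have "graph_dist \<Gamma> u v = \<infinity>" by (simp add: graph_dist_def top_enat_def)
      then show False using that by simp
    qed
    then have "Inf ?L \<in> ?L" by (meson equals0I wellorder_InfI)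
    then obtain p where "Inf ?L = enat (length p - 1)" "walk_betw \<Gamma> u p v" by blast
    then have "m = length p - 1" "walk_betw \<Gamma> u p v" using that by (simp_all add: graph_dist_def)
    then show ?thesis using len by (auto simp: walk_of_length_def)
  qed
  show "walk_of_length \<Gamma> n u v \<and> (\<forall>m<n. \<not> walk_of_length \<Gamma> m u v)" if "graph_dist \<Gamma> u v = enat n"
    using att[OF that] low that by fastforce
  show "graph_dist \<Gamma> u v = enat n"
    if *: "walk_of_length \<Gamma> n u v \<and> (\<forall>m<n. \<not> walk_of_length \<Gamma> m u v)"
  proof -
    obtain k where k: "graph_dist \<Gamma> u v = enat k" "k \<le> n"
      using low[of n] * by (cases "graph_dist \<Gamma> u v") auto
    with att[OF k(1)] * show ?thesis by (metis le_neq_implies_less)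
  qed
qed

lemma mem_dist_set_iff:
  "u \<in> dist_set \<Gamma> n v \<longleftrightarrow>
     u \<in> verts \<Gamma> \<and> walk_of_length \<Gamma> n v u \<and> (\<forall>m<n. \<not> walk_of_length \<Gamma> m v u)"
  by (auto simp: dist_set_def graph_dist_eq_enat_iff)

text \<open>
  A geodesic is an arc: if it returned to a vertex after two steps, those two steps could be cut out,
  leaving a shorter walk with the same ends.
\<close>

lemma ex_arc_to_dist_set:
  assumes u: "u \<in> dist_set \<Gamma> n v"
  shows "\<exists>p\<in>arcs_from \<Gamma> n v. last p = u"
proof -
  obtain p where p: "walk_betw \<Gamma> v p u" "length p = Suc n"
    using u by (auto simp: mem_dist_set_iff walk_of_length_def)
  have adj: "{p ! (j - 1), p ! j} \<in> edges \<Gamma>" if "j \<in> {1..n}" for j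
    using p that successively_nth[of _ p "j - 1"] by (auto simp: walk_betw_def)
  have "p ! (j - 1) \<noteq> p ! (j + 1)" if j: "j \<in> {1..n - 1}" for j
  proof
    assume eq: "p ! (j - 1) = p ! (j + 1)"
    define xs where "xs = take (j - 1) p"
    have len: "Suc (Suc (Suc 0)) \<le> length (drop (j - 1) p)" using j p(2) by auto
    then obtain a b c ys where ys: "drop (j - 1) p = a # b # c # ys"
      unfolding Suc_le_length_iff by blast
    then have p_eq: "p = xs @ a # b # c # ys" unfolding xs_def by (metis append_take_drop_id)
    have j_eq: "j = Suc (length xs)" using j p(2) by (auto simp: xs_def)
    have "c = a" using eq unfolding p_eq j_eq by (simp add: nth_append)
    with p_eq have ps: "p = xs @ a # b # a # ys" by simp
    let ?q = "xs @ a # ys"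
    have "walk_betw \<Gamma> v ?q u"
      using p(1) unfolding ps walk_betw_def
      by (auto simp: successively_append_iff successively_Cons hd_append split: if_splits)
    moreover have "length ?q = Suc (n - 2)" "n - 2 < n" using p(2) unfolding ps by auto
    ultimately have "walk_of_length \<Gamma> (n - 2) v u" unfolding walk_of_length_def by blast
    then show False using u \<open>n - 2 < n\<close> by (auto simp: mem_dist_set_iff)
  qed
  then have "p \<in> arcs_from \<Gamma> n v" "last p = u"
    using p adj by (auto simp: arcs_from_def arcs_def walk_betw_def)
  then show ?thesis by blast
qed

lemma transitive_on_dist_set_if_arcs:
  assumes "transitive_on H (\<lambda>g. map (\<phi> g)) (arcs_from \<Gamma> n v)"
  shows "transitive_on H \<phi> (dist_set \<Gamma> n v)"
  unfolding transitive_on_def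
proof (intro ballI)
  fix x y assume "x \<in> dist_set \<Gamma> n v" "y \<in> dist_set \<Gamma> n v"
  then obtain p q where pq: "p \<in> arcs_from \<Gamma> n v" "q \<in> arcs_from \<Gamma> n v" "last p = x" "last q = y"
    using ex_arc_to_dist_set by metis
  then obtain g where "g \<in> H" "map (\<phi> g) p = q" using assms by (auto simp: transitive_on_def)
  moreover have "p \<noteq> []" using pq(1) by (auto simp: arcs_from_def arcs_def)
  ultimately show "\<exists>g\<in>H. \<phi> g x = y" using pq(3,4) by (auto simp: last_map)
qed

lemma arcs_1: "arcs \<Gamma> (Suc 0) = {[x, y] | x y. {x, y} \<subseteq> verts \<Gamma> \<and> {x, y} \<in> edges \<Gamma>}"
proof (rule Set.set_eqI)
  show "p \<in> arcs \<Gamma> (Suc 0) \<longleftrightarrow> p \<in> {[x, y] | x y. {x, y} \<subseteq> verts \<Gamma> \<and> {x, y} \<in> edges \<Gamma>}" for p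
  proof (cases "length p = 2")
    case True
    then obtain x y where "p = [x, y]" by (auto simp: length_Suc_conv numeral_2_eq_2)
    then show ?thesis by (simp add: arcs_def)
  qed (auto simp: arcs_def)
qed

lemma arcs_2:
  "arcs \<Gamma> 2 = {[x, y, z] | x y z. {x, y, z} \<subseteq> verts \<Gamma> \<and> {x, y} \<in> edges \<Gamma> \<and> {y, z} \<in> edges \<Gamma> \<and> x \<noteq> z}"
  (is "_ = ?A")
proof (rule Set.set_eqI)
  have I: "{Suc 0..2} = {1, 2}" by auto
  show "p \<in> arcs \<Gamma> 2 \<longleftrightarrow> p \<in> ?A" for p
  proof (cases "length p = 3")
    case True
    then obtain x y z where "p = [x, y, z]" by (auto simp: length_Suc_conv numeral_3_eq_3)
    then show ?thesis by (simp add: arcs_def I)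
  qed (auto simp: arcs_def)
qed

lemma arcs_3:
  "arcs \<Gamma> 3 = {[w, x, y, z] | w x y z. {w, x, y, z} \<subseteq> verts \<Gamma> \<and>
     {w, x} \<in> edges \<Gamma> \<and> {x, y} \<in> edges \<Gamma> \<and> {y, z} \<in> edges \<Gamma> \<and> w \<noteq> y \<and> x \<noteq> z}"
  (is "_ = ?A")
proof (rule Set.set_eqI)
  have I: "{Suc 0..3} = {1, 2, 3}" "{Suc 0..2} = {1, 2}" by auto
  show "p \<in> arcs \<Gamma> 3 \<longleftrightarrow> p \<in> ?A" for p
  proof (cases "length p = 4")
    case True
    then have "length p = Suc (Suc (Suc (Suc 0)))" by simp
    then obtain w x y z where "p = [w, x, y, z]" by (auto simp: length_Suc_conv)
    then show ?thesis by (simp add: arcs_def I)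
  qed (auto simp: arcs_def)
qed

lemma connected_walk_of_length:
  assumes "connected_graph \<Gamma>" "u \<in> verts \<Gamma>" "v \<in> verts \<Gamma>"
  obtains n where "walk_of_length \<Gamma> n u v"
proof -
  obtain p where "walk_betw \<Gamma> u p v" using assms by (auto simp: connected_graph_def)
  moreover from this obtain n where "length p = Suc n"
    by (cases p) (auto simp: walk_betw_def)
  ultimately show ?thesis using that by (auto simp: walk_of_length_def)
qed

text \<open>
  Induction along a walk, for properties that pass from a vertex to its neighbours.
\<close>

lemma walk_of_length_closed:
  assumes "walk_of_length \<Gamma> n u v" "P u"
    and "\<And>x y. P x \<Longrightarrow> {x, y} \<in> edges \<Gamma> \<Longrightarrow> P y"
  shows "P v"
  using assms(1,2)
  by (induction n arbitrary: u) (auto simp: walk_of_length_0 walk_of_length_Suc intro: assms(3))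

section \<open>Existence of a 2-arc\<close>

lemma isomorphic_K2:
  assumes "simple_graph \<Gamma>" "verts \<Gamma> = {x, y}" "{x, y} \<in> edges \<Gamma>"
  shows "isomorphic_graphs \<Gamma> (complete_graph 2)"
proof -
  have E: "{a, b} \<in> edges \<Gamma> \<Longrightarrow> a \<noteq> b" for a b
    using assms(1) by (auto elim: simple_graph_edgeE)
  have xy: "x \<noteq> y" using E assms(3) .
  let ?f = "\<lambda>a. if a = x then 0 else 1 :: nat"
  have "bij_betw ?f {x, y} {..<2}"
    using xy by (auto simp: bij_betw_def inj_on_def lessThan_nat_numeral lessThan_Suc numeral_2_eq_2)
  then have "graph_iso ?f \<Gamma> (complete_graph 2)"
    unfolding graph_iso_def assms(2)
    using xy assms(3) E[of x x] E[of y y]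
    by (auto simp: complete_graph_def nsets_def insert_commute)
  then show ?thesis by (auto simp: isomorphic_graphs_def)
qed

text \<open>
  If there is no 2-arc, each vertex has a single neighbour, so the two ends of an edge form a
  connected component.
\<close>

lemma arcs_2_nonempty:
  assumes S: "simple_graph \<Gamma>" and C: "connected_graph \<Gamma>"
    and card: "finite (verts \<Gamma>) \<longrightarrow> 2 \<le> card (verts \<Gamma>)"
    and nK: "\<not> isomorphic_graphs \<Gamma> (complete_graph 2)"
  shows "arcs \<Gamma> 2 \<noteq> {}"
proof
  assume no: "arcs \<Gamma> 2 = {}"
  have E: "a \<in> verts \<Gamma>" "b \<in> verts \<Gamma>" "a \<noteq> b" if "{a, b} \<in> edges \<Gamma>" for a b
    using simple_graph_edgeE[OF S that] by (metis doubleton_eq_iff)+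
  have no2: "x = z" if "{x, y} \<in> edges \<Gamma>" "{y, z} \<in> edges \<Gamma>" for x y z
    using no that E[OF that(1)] E[OF that(2)] unfolding arcs_2 by blast
  have edge: "\<exists>y. {x, y} \<in> edges \<Gamma>" if "x \<in> verts \<Gamma>" for x
  proof -
    have "\<not> verts \<Gamma> \<subseteq> {x}"
    proof
      assume sub: "verts \<Gamma> \<subseteq> {x}"
      then have "finite (verts \<Gamma>)" by (rule finite_subset) simp
      then show False using card card_mono[OF _ sub] by simp
    qed
    then obtain v where "v \<in> verts \<Gamma>" "v \<noteq> x" by blast
    moreover obtain n where "walk_of_length \<Gamma> n x v"
      using connected_walk_of_length[OF C \<open>x \<in> verts \<Gamma>\<close> \<open>v \<in> verts \<Gamma>\<close>] .
    ultimately show ?thesis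
      by (cases n) (auto simp: walk_of_length_0 walk_of_length_Suc)
  qed
  obtain x where "x \<in> verts \<Gamma>" using C by (auto simp: connected_graph_def)
  then obtain y where xy: "{x, y} \<in> edges \<Gamma>" using edge by blast
  have yx: "{y, x} \<in> edges \<Gamma>" using xy by (simp add: insert_commute)
  have "v = x \<or> v = y" if v: "v \<in> verts \<Gamma>" for v
  proof -
    obtain n where "walk_of_length \<Gamma> n x v"
      using connected_walk_of_length[OF C E(1)[OF xy] v] .
    then show ?thesis
      by (rule walk_of_length_closed) (use no2[OF xy] no2[OF yx] in auto)
  qed
  then have "verts \<Gamma> = {x, y}" using E[OF xy] by blast
  then show False using isomorphic_K2[OF S _ xy] nK by blast
qed

section \<open>Automorphisms acting on the subdivision graph\<close>

locale graph_automorphisms =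
  fixes \<Sigma> :: "'a ugraph" and G :: "('a \<Rightarrow> 'a) set"
  assumes simple: "simple_graph \<Sigma>"
    and subgroup: "subgroup G (aut_group \<Sigma>)"
begin

abbreviation "\<G> \<equiv> aut_group \<Sigma> \<lparr>carrier := G\<rparr>"
abbreviation "S \<equiv> subdivision \<Sigma>"
abbreviation "\<phi> \<equiv> subdivision_action \<Sigma>"

lemma edge_verts:
  assumes "{x, y} \<in> edges \<Sigma>"
  shows "x \<in> verts \<Sigma>" "y \<in> verts \<Sigma>" "x \<noteq> y"
  using simple_graph_edgeE[OF simple assms] by (metis doubleton_eq_iff)+

lemma edge_containing:
  assumes "e \<in> edges \<Sigma>" "x \<in> e"
  obtains y where "e = {x, y}"
  using simple_graph_edgeE[OF simple assms(1)] assms(2) by (metis insert_commute insertE singletonD)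

lemma aut: "g \<in> G \<Longrightarrow> g \<in> graph_aut \<Sigma>"
  using subgroup.subset[OF subgroup] by (auto simp: aut_group_def)

lemma inj: "g \<in> G \<Longrightarrow> inj_on g (verts \<Sigma>)"
  using aut by (auto simp: graph_aut_def Bij_def bij_betw_def)

lemma maps_edge: "g \<in> G \<Longrightarrow> {x, y} \<in> edges \<Sigma> \<Longrightarrow> {g x, g y} \<in> edges \<Sigma>"
  using graph_aut_image_edge[OF simple aut, of g "{x, y}"] by simp

lemma action_Inl: "x \<in> verts \<Sigma> \<Longrightarrow> \<phi> g (Inl x) = Inl (g x)"
  and action_Inr: "e \<in> edges \<Sigma> \<Longrightarrow> \<phi> g (Inr e) = Inr (g ` e)"
  by (auto simp: subdivision_action_def subdivision_def)

lemma stabilizer_Inl: "x \<in> verts \<Sigma> \<Longrightarrow> g \<in> stabilizer \<G> \<phi> (Inl x) \<longleftrightarrow> g \<in> G \<and> g x = x"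
  and stabilizer_Inr: "e \<in> edges \<Sigma> \<Longrightarrow> g \<in> stabilizer \<G> \<phi> (Inr e) \<longleftrightarrow> g \<in> G \<and> g ` e = e"
  by (auto simp: stabilizer_def action_Inl action_Inr)

lemma identity:
  obtains g where "g \<in> G" "\<And>x. x \<in> verts \<Sigma> \<Longrightarrow> g x = x"
  using subgroup.one_closed[OF subgroup] by (auto simp: aut_group_def BijGroup_def)

lemma composition:
  assumes "g \<in> G" "h \<in> G"
  obtains k where "k \<in> G" "\<And>x. x \<in> verts \<Sigma> \<Longrightarrow> k x = g (h x)"
proof -
  have "g \<in> Bij (verts \<Sigma>)" "h \<in> Bij (verts \<Sigma>)" using assms aut by (auto simp: graph_aut_def)
  then show ?thesis
    using that[OF subgroup.m_closed[OF subgroup assms]]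
    by (simp add: aut_group_def BijGroup_def compose_eq)
qed

section \<open>Distances in the subdivision graph\<close>

lemma subdivision_verts: "Inl x \<in> verts S \<longleftrightarrow> x \<in> verts \<Sigma>" "Inr e \<in> verts S \<longleftrightarrow> e \<in> edges \<Sigma>"
  by (auto simp: subdivision_def)

lemma subdivision_edge_sum_cases:
  "{Inl x, p} \<in> edges S \<longleftrightarrow> (\<exists>e. p = Inr e \<and> x \<in> verts \<Sigma> \<and> e \<in> edges \<Sigma> \<and> x \<in> e)"
  "{Inr e, p} \<in> edges S \<longleftrightarrow> (\<exists>x. p = Inl x \<and> x \<in> verts \<Sigma> \<and> e \<in> edges \<Sigma> \<and> x \<in> e)"
  by (cases p; simp add: subdivision_adj_iff)+

lemmas subdivision_walk_simps =
  mem_dist_set_iff walk_of_length_Suc walk_of_length_0 subdivision_verts subdivision_edge_sum_cases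
  numeral_2_eq_2 less_Suc_eq

lemma dist_set_1_edge: "{x, y} \<in> edges \<Sigma> \<Longrightarrow> Inl y \<in> dist_set S 1 (Inr {x, y})"
  using edge_verts[of x y] by (auto simp: subdivision_walk_simps)

lemma dist_set_2_vertex: "{x, y} \<in> edges \<Sigma> \<Longrightarrow> Inl y \<in> dist_set S 2 (Inl x)"
  using edge_verts[of x y] by (auto simp: subdivision_walk_simps)

lemma dist_set_2_edge:
  assumes "{x, y} \<in> edges \<Sigma>" "{y, z} \<in> edges \<Sigma>" "x \<noteq> z"
  shows "Inr {y, z} \<in> dist_set S 2 (Inr {x, y})"
  using assms edge_verts[OF assms(1)] edge_verts[OF assms(2)]
  by (auto simp: subdivision_walk_simps doubleton_eq_iff)

text \<open>
  There is no shorter walk: those of lengths 0 and 2 end in vertices of \<open>\<Sigma>\<close>, and one of length 1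
  would need \<open>x\<close> to lie on \<open>{y, z}\<close>.
\<close>

lemma dist_set_3_vertex:
  assumes xy: "{x, y} \<in> edges \<Sigma>" and yz: "{y, z} \<in> edges \<Sigma>" and "x \<noteq> z"
  shows "Inr {y, z} \<in> dist_set S 3 (Inl x)"
proof -
  note V = edge_verts[OF xy] edge_verts[OF yz]
  have "walk_betw S (Inl x) [Inl x, Inr {x, y}, Inl y, Inr {y, z}] (Inr {y, z})"
    using V xy yz by (simp add: walk_betw_def subdivision_verts subdivision_edge_sum_cases)
  then have "walk_of_length S 3 (Inl x) (Inr {y, z})"
    unfolding walk_of_length_def by (intro exI conjI) auto
  moreover have "\<not> walk_of_length S m (Inl x) (Inr {y, z})" if "m < 3" for m
  proof -
    have "m = 0 \<or> m = 1 \<or> m = 2" using that by auto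
    then show ?thesis
      using V \<open>x \<noteq> z\<close>
      by (auto simp: walk_of_length_Suc walk_of_length_0 subdivision_edge_sum_cases numeral_2_eq_2)
  qed
  ultimately show ?thesis using yz by (simp add: mem_dist_set_iff subdivision_verts)
qed

section \<open>Arcs in the subdivision graph\<close>

text \<open>
  The walk in the subdivision graph that traces a given walk of the original graph, visiting each
  edge as a vertex on the way.
\<close>

fun subdivide :: "'b list \<Rightarrow> ('b + 'b set) list" where
  "subdivide (x # y # p) = Inl x # Inr {x, y} # subdivide (y # p)"
| "subdivide [x] = [Inl x]"
| "subdivide [] = []"

lemma map_action_subdivide:
  assumes "successively (\<lambda>x y. {x, y} \<in> edges \<Sigma>) p" "set p \<subseteq> verts \<Sigma>"
  shows "map (\<phi> g) (subdivide p) = subdivide (map g p)"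
  using assms by (induction p rule: subdivide.induct) (auto simp: action_Inl action_Inr)

text \<open>
  In \<open>S\<close> two steps from a vertex through an edge lead to the other end of that edge, and two steps
  from an edge through a vertex lead to a different edge at that vertex.  So an arc that starts at a
  vertex traces an arc of \<open>\<Sigma>\<close>, and one that starts at an edge becomes such a trace once the other
  end of that edge is put in front; if it stops at an edge, the missing end of the edge completes
  the trace.  The length of \<open>a\<close> is the least \<open>n\<close> for which the trace, which takes \<open>2 * n\<close> steps,
  leaves room for \<open>i\<close> steps after the first \<open>k\<close>.

  The offset \<open>k\<close> and the length of the arc \<open>a\<close> depend only on \<open>i\<close> and on whether \<open>v\<close> is a vertex or
  an edge of \<open>\<Sigma>\<close>.  Hence two \<open>i\<close>-arcs from \<open>v\<close> are cut from the traces of two arcs of equal length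
  by the same \<open>take\<close> and \<open>drop\<close>, and an element that maps one of these arcs to the other
  maps the one \<open>i\<close>-arc to the other.
\<close>

lemma arc_in_subdivision:
  assumes p: "p \<in> arcs_from S i v" and i: "i \<in> {1..3}"
  defines "k \<equiv> if isl v then 0 else 1"
  shows "\<exists>a\<in>arcs \<Sigma> ((i + k + 1) div 2). p = take (i + 1) (drop k (subdivide a))"
proof -
  consider "i = 1" | "i = 2" | "i = 3" using i by fastforce
  then show ?thesis
  proof cases
    case 1
    obtain b where b: "p = [v, b]" "{v, b} \<in> edges S"
      using p unfolding 1 One_nat_def arcs_from_def arcs_1 by fastforce
    show ?thesis
    proof (cases v)
      case (Inl x)
      then obtain e where e: "p = [Inl x, Inr e]" "e \<in> edges \<Sigma>" "x \<in> e"
        using b unfolding Inl by (auto simp: subdivision_edge_sum_cases)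
      then obtain y where "e = {x, y}" using edge_containing by metis
      with e show ?thesis
        using edge_verts[of x y] unfolding 1 k_def Inl
        by (intro bexI[of _ "[x, y]"]) (auto simp: arcs_1)
    next
      case (Inr e)
      then obtain y where e: "p = [Inr e, Inl y]" "e \<in> edges \<Sigma>" "y \<in> e"
        using b unfolding Inr by (auto simp: subdivision_edge_sum_cases)
      then obtain x where "e = {x, y}" using edge_containing by (metis insert_commute)
      with e show ?thesis
        using edge_verts[of x y] unfolding 1 k_def Inr
        by (intro bexI[of _ "[x, y]"]) (auto simp: arcs_1)
    qed
  next
    case 2
    obtain b c where b: "p = [v, b, c]" "{v, b} \<in> edges S" "{b, c} \<in> edges S" "v \<noteq> c"
      using p unfolding 2 arcs_from_def arcs_2 by fastforce
    show ?thesis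
    proof (cases v)
      case (Inl x)
      then obtain e y where e: "p = [Inl x, Inr e, Inl y]" "e \<in> edges \<Sigma>" "x \<in> e" "y \<in> e"
        using b unfolding Inl by (auto simp: subdivision_edge_sum_cases)
      moreover have "x \<noteq> y" using e(1) b(1,4) Inl by auto
      ultimately have "e = {x, y}" using edge_containing by (metis insertE singletonD)
      with e show ?thesis
        using edge_verts[of x y] unfolding 2 k_def Inl
        by (intro bexI[of _ "[x, y]"]) (auto simp: arcs_1)
    next
      case (Inr e)
      then obtain y f where e: "p = [Inr e, Inl y, Inr f]" "e \<in> edges \<Sigma>" "y \<in> e"
          "f \<in> edges \<Sigma>" "y \<in> f"
        using b unfolding Inr by (auto simp: subdivision_edge_sum_cases)
      moreover have "e \<noteq> f" using e(1) b(1,4) Inr by auto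
      ultimately obtain x z where "e = {x, y}" "f = {y, z}" using edge_containing by (metis insert_commute)
      with e \<open>e \<noteq> f\<close> show ?thesis
        using edge_verts[of x y] edge_verts[of y z] unfolding 2 k_def Inr
        by (intro bexI[of _ "[x, y, z]"]) (auto simp: arcs_2)
    qed
  next
    case 3
    obtain b c d where b: "p = [v, b, c, d]" "{v, b} \<in> edges S" "{b, c} \<in> edges S"
        "{c, d} \<in> edges S" "v \<noteq> c" "b \<noteq> d"
      using p unfolding 3 arcs_from_def arcs_3 by fastforce
    show ?thesis
    proof (cases v)
      case (Inl x)
      then obtain e y f where e: "p = [Inl x, Inr e, Inl y, Inr f]" "e \<in> edges \<Sigma>" "x \<in> e" "y \<in> e"
          "f \<in> edges \<Sigma>" "y \<in> f"
        using b unfolding Inl by (auto simp: subdivision_edge_sum_cases)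
      moreover have ne: "x \<noteq> y" "e \<noteq> f" using e(1) b(1,5,6) Inl by auto
      ultimately obtain z where "e = {x, y}" "f = {y, z}"
        using edge_containing by (metis insertE singletonD)
      with e ne show ?thesis
        using edge_verts[of x y] edge_verts[of y z] unfolding 3 k_def Inl
        by (intro bexI[of _ "[x, y, z]"]) (auto simp: arcs_2)
    next
      case (Inr e)
      then obtain y f z where e: "p = [Inr e, Inl y, Inr f, Inl z]" "e \<in> edges \<Sigma>" "y \<in> e"
          "f \<in> edges \<Sigma>" "y \<in> f" "z \<in> f"
        using b unfolding Inr by (auto simp: subdivision_edge_sum_cases)
      moreover have ne: "y \<noteq> z" "e \<noteq> f" using e(1) b(1,5,6) Inr by auto
      ultimately have f: "f = {y, z}" using edge_containing by (metis insertE singletonD)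
      obtain x where "e = {x, y}" using e edge_containing by (metis insert_commute)
      with e ne f show ?thesis
        using edge_verts[of x y] edge_verts[of y z] unfolding 3 k_def Inr
        by (intro bexI[of _ "[x, y, z]"]) (auto simp: arcs_2)
    qed
  qed
qed

section \<open>The four implications\<close>

text \<open>
  The successive steps are: edges can be reversed (\<open>swap\<close>), vertex stabilisers are transitive on
  neighbours (\<open>nbr\<close>), and stabilisers of 1-arcs are transitive on the extensions to 2-arcs
  (\<open>fix_arc\<close>).  The three combine to transitivity on vertices, then 1-arcs, then 2-arcs.
\<close>

lemma arc_transitive_2_if_locally_distance_transitive_2:
  assumes conn: "connected_graph \<Sigma>" and ne: "arcs \<Sigma> 2 \<noteq> {}"
    and ldt: "locally_distance_transitive \<G> \<phi> S 2"
  shows "arc_transitive \<G> (\<lambda>g. g) \<Sigma> 2"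
proof -
  have tr: "\<exists>g\<in>stabilizer \<G> \<phi> v. \<phi> g p = q"
    if "v \<in> verts S" "i \<in> {1..2}" "p \<in> dist_set S i v" "q \<in> dist_set S i v" for v i p q
    using ldt that unfolding locally_distance_transitive_def transitive_on_def by blast
  have swap: "\<exists>g\<in>G. g x = y" if xy: "{x, y} \<in> edges \<Sigma>" for x y
    using tr[of "Inr {x, y}" 1, OF _ _ dist_set_1_edge[of y x, simplified insert_commute]
        dist_set_1_edge[OF xy]] xy edge_verts[OF xy]
    by (auto simp: subdivision_verts stabilizer_Inr action_Inl insert_commute)
  have nbr: "\<exists>g\<in>G. g x = x \<and> g y = z" if xy: "{x, y} \<in> edges \<Sigma>" and xz: "{x, z} \<in> edges \<Sigma>" for x y z
    using tr[of "Inl x" 2, OF _ _ dist_set_2_vertex[OF xy] dist_set_2_vertex[OF xz]]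
      edge_verts[OF xy]
    by (auto simp: subdivision_verts stabilizer_Inl action_Inl)
  have fix_arc: "\<exists>g\<in>G. g x = x \<and> g y = y \<and> g z = w"
    if xy: "{x, y} \<in> edges \<Sigma>" and yz: "{y, z} \<in> edges \<Sigma>" "x \<noteq> z"
      and yw: "{y, w} \<in> edges \<Sigma>" "x \<noteq> w" for x y z w
  proof -
    obtain g where "g \<in> stabilizer \<G> \<phi> (Inr {x, y})" "\<phi> g (Inr {y, z}) = Inr {y, w}"
      using tr[of "Inr {x, y}" 2, OF _ _ dist_set_2_edge[OF xy yz] dist_set_2_edge[OF xy yw]] xy
      by (auto simp: subdivision_verts)
    then have g: "g \<in> G" "{g x, g y} = {x, y}" "{g y, g z} = {y, w}"
      using xy yz by (simp_all add: stabilizer_Inr action_Inr)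
    \<comment> \<open>The common vertex of two edges is carried to the common vertex of their images.\<close>
    have "g y = y" using g(2,3) edge_verts[OF xy] yw(2) by (metis doubleton_eq_iff)
    then show ?thesis using g by (metis doubleton_eq_iff)
  qed
  have vertex: "\<exists>g\<in>G. g u = v" if uv: "u \<in> verts \<Sigma>" "v \<in> verts \<Sigma>" for u v
  proof -
    obtain n where "walk_of_length \<Sigma> n u v" using connected_walk_of_length[OF conn uv] .
    then show ?thesis
    proof (rule walk_of_length_closed)
      show "\<exists>g\<in>G. g u = u" using identity uv by metis
      fix x y assume "\<exists>g\<in>G. g u = x" "{x, y} \<in> edges \<Sigma>"
      then show "\<exists>g\<in>G. g u = y" using swap composition uv(1) by metis
    qed
  qed
  have arc: "\<exists>g\<in>G. g x = x' \<and> g y = y'"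
    if xy: "{x, y} \<in> edges \<Sigma>" and xy': "{x', y'} \<in> edges \<Sigma>" for x y x' y'
  proof -
    obtain g where g: "g \<in> G" "g x = x'"
      using vertex edge_verts[OF xy] edge_verts[OF xy'] by blast
    moreover obtain h where "h \<in> G" "h x' = x'" "h (g y) = y'"
      using nbr[of x' "g y" y'] maps_edge[OF g(1) xy] xy' g(2) by blast
    ultimately show ?thesis using composition edge_verts[OF xy] by metis
  qed
  have arc2: "\<exists>g\<in>G. g x = x' \<and> g y = y' \<and> g z = z'"
    if xy: "{x, y} \<in> edges \<Sigma>" and yz: "{y, z} \<in> edges \<Sigma>" "x \<noteq> z"
      and xy': "{x', y'} \<in> edges \<Sigma>" and yz': "{y', z'} \<in> edges \<Sigma>" "x' \<noteq> z'" for x y z x' y' z'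
  proof -
    obtain g where g: "g \<in> G" "g x = x'" "g y = y'" using arc[OF xy xy'] by blast
    have "x' \<noteq> g z"
      using inj_onD[OF inj[OF g(1)], of x z] g(2) yz edge_verts[OF xy] edge_verts[OF yz(1)] by auto
    moreover have "{y', g z} \<in> edges \<Sigma>" using maps_edge[OF g(1) yz(1)] g(3) by simp
    ultimately obtain h where "h \<in> G" "h x' = x'" "h y' = y'" "h (g z) = z'"
      using fix_arc[OF xy' _ _ yz'] by blast
    then show ?thesis using composition g edge_verts[OF xy] edge_verts[OF yz(1)] by metis
  qed
  have "transitive_on G map (arcs \<Sigma> i)" if "i \<in> {1..2}" for i
  proof -
    consider "i = 1" | "i = 2" using \<open>i \<in> {1..2}\<close> by fastforce
    then show ?thesis
    proof cases
      case 1
      show ?thesis unfolding 1 One_nat_def arcs_1 transitive_on_def using arc by fastforce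
    next
      case 2
      show ?thesis unfolding 2 arcs_2 transitive_on_def using arc2 by fastforce
    qed
  qed
  then show ?thesis using ne by (simp add: arc_transitive_def)
qed

text \<open>
  An element obtained from the transitivity of \<open>G\<close> on arcs of \<open>\<Sigma>\<close> fixes \<open>v\<close> of its own accord,
  because \<open>v\<close> is the first entry both of an arc in \<open>S\<close> and of its image.
\<close>

lemma locally_arc_transitive_3_if_arc_transitive_2:
  assumes "arc_transitive \<G> (\<lambda>g. g) \<Sigma> 2"
  shows "locally_arc_transitive \<G> \<phi> S 3"
  unfolding locally_arc_transitive_def
proof (intro conjI ballI)
  fix v i assume v: "v \<in> verts S" and i: "i \<in> {1..3::nat}"
  define k n :: nat where "k = (if isl v then 0 else 1)" and "n = (i + k + 1) div 2"
  have n: "n \<in> {1..2}" using i by (auto simp: n_def k_def)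
  show "transitive_on (stabilizer \<G> \<phi> v) (\<lambda>g. map (\<phi> g)) (arcs_from S i v)"
    unfolding transitive_on_def
  proof (intro ballI)
    fix p q assume p: "p \<in> arcs_from S i v" and q: "q \<in> arcs_from S i v"
    obtain a where a: "a \<in> arcs \<Sigma> n" "p = take (i + 1) (drop k (subdivide a))"
      using arc_in_subdivision[OF p i] by (auto simp: k_def n_def)
    obtain b where b: "b \<in> arcs \<Sigma> n" "q = take (i + 1) (drop k (subdivide b))"
      using arc_in_subdivision[OF q i] by (auto simp: k_def n_def)
    obtain g where g: "g \<in> G" "map g a = b"
      using assms n a(1) b(1) unfolding arc_transitive_def transitive_on_def by force
    have "n = 1 \<or> n = 2" using n by auto
    then have "map (\<phi> g) (subdivide a) = subdivide b"
      using a(1) g(2) by (intro map_action_subdivide[of a g, THEN trans])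
        (auto simp: arcs_1 arcs_2)
    then have pq: "map (\<phi> g) p = q" unfolding a(2) b(2) by (simp flip: take_map drop_map)
    have "p \<noteq> []" "hd p = v" "hd q = v" using p q by (auto simp: arcs_from_def arcs_def)
    then have "\<phi> g v = v" using pq by (metis hd_map)
    then show "\<exists>g\<in>stabilizer \<G> \<phi> v. map (\<phi> g) p = q"
      using g(1) pq by (auto simp: stabilizer_def)
  qed
next
  obtain x y z where "[x, y, z] \<in> arcs \<Sigma> 2"
    using assms by (auto simp: arc_transitive_def arcs_2)
  then have "Inl x \<in> verts S" "Inr {y, z} \<in> dist_set S 3 (Inl x)"
    using dist_set_3_vertex by (auto simp: arcs_2 subdivision_verts)
  then show "\<exists>v\<in>verts S. arcs_from S 3 v \<noteq> {}" using ex_arc_to_dist_set by (metis empty_iff)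
qed

lemma locally_distance_transitive_3_if_locally_arc_transitive_3:
  assumes ne: "arcs \<Sigma> 2 \<noteq> {}" and lat: "locally_arc_transitive \<G> \<phi> S 3"
  shows "locally_distance_transitive \<G> \<phi> S 3"
proof -
  obtain x y z where "[x, y, z] \<in> arcs \<Sigma> 2" using ne by (auto simp: arcs_2)
  then have "Inl x \<in> verts S" "Inr {y, z} \<in> dist_set S 3 (Inl x)"
    using dist_set_3_vertex by (auto simp: arcs_2 subdivision_verts)
  then show ?thesis
    using lat transitive_on_dist_set_if_arcs
    unfolding locally_distance_transitive_def locally_arc_transitive_def by (metis empty_iff)
qed

text \<open>
  The 2-arc supplies a pair of vertices at distance exactly 2, which the definition demands besides
  transitivity.
\<close>

lemma locally_distance_transitive_2_if_3:
  assumes ne: "arcs \<Sigma> 2 \<noteq> {}" and ldt: "locally_distance_transitive \<G> \<phi> S 3"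
  shows "locally_distance_transitive \<G> \<phi> S 2"
proof -
  obtain x y z where "[x, y, z] \<in> arcs \<Sigma> 2" using ne by (auto simp: arcs_2)
  then have "Inl x \<in> verts S" "Inl y \<in> dist_set S 2 (Inl x)"
    using dist_set_2_vertex by (auto simp: arcs_2 subdivision_verts)
  then show ?thesis using ldt by (fastforce simp: locally_distance_transitive_def)
qed

end

theorem corollary4p2:
  fixes \<Sigma> :: "'a ugraph" and G :: "('a \<Rightarrow> 'a) set" and d \<delta> :: nat
  defines "\<G> \<equiv> aut_group \<Sigma> \<lparr>carrier := G\<rparr>"
  assumes "simple_graph \<Sigma>" and "connected_graph \<Sigma>"
    and "graph_diameter \<Sigma> = enat d"
    and "finite (verts \<Sigma>) \<longrightarrow> 2 \<le> card (verts \<Sigma>)"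
    and "\<delta> \<in> {0, 1, 2}" and "graph_diameter (subdivision \<Sigma>) = enat (2 * d + \<delta>)"
    and "subgroup G (aut_group \<Sigma>)"
    and "\<not> isomorphic_graphs \<Sigma> (complete_graph 2)"
  shows "(locally_distance_transitive \<G> (subdivision_action \<Sigma>) (subdivision \<Sigma>) 2
            \<longleftrightarrow> arc_transitive \<G> (\<lambda>g. g) \<Sigma> 2)
       \<and> (arc_transitive \<G> (\<lambda>g. g) \<Sigma> 2
            \<longleftrightarrow> locally_arc_transitive \<G> (subdivision_action \<Sigma>) (subdivision \<Sigma>) 3)
       \<and> (locally_arc_transitive \<G> (subdivision_action \<Sigma>) (subdivision \<Sigma>) 3
            \<longleftrightarrow> locally_distance_transitive \<G> (subdivision_action \<Sigma>) (subdivision \<Sigma>) 3)"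
proof -
  interpret graph_automorphisms \<Sigma> G
    using assms(2,8) by (rule graph_automorphisms.intro)
  have ne: "arcs \<Sigma> 2 \<noteq> {}"
    using arcs_2_nonempty assms(2,3,5,9) by blast
  show ?thesis
    unfolding assms(1)
    using arc_transitive_2_if_locally_distance_transitive_2[OF assms(3) ne]
      locally_arc_transitive_3_if_arc_transitive_2
      locally_distance_transitive_3_if_locally_arc_transitive_3[OF ne]
      locally_distance_transitive_2_if_3[OF ne]
    by blast
qed

end
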